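(* (i) If $n\ge 3$ and $S=\langle F_n,F_{n+2},F_{n+4},\ldots\rangle$, then $\mathbf{F}(S)=F_{2n}-F_{n+2}$. (ii) If $n\ge 4$ and $S=\langle L_n,L_{n+2},L_{n+4},\ldots\rangle$, then $\mathbf{F}(S)=L_{2n+1}+L_{2n-1}-L_{n+2}$.
   Context: For a set $A$ of positive integers, $\langle A\rangle$ denotes the set of all finite linear combinations of elements of $A$ with non-negative integer coefficients. The Frobenius number $\mathbf{F}(S)$ is the largest element of $\mathbb{Z}_{\ge 0}\setminus S$. $F_m$ is the Fibonacci sequence ($F_1=F_2=1$, $F_m=F_{m-1}+F_{m-2}$) and $L_m$ is the Lucas sequence ($L_1=1$, $L_2=3$, $L_m=L_{m-1}+L_{m-2}$). *)

theory Defs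
  imports Complex_Main "HOL-Number_Theory.Fib"
begin

(* The value 2 at index 0 is the one for which L_2 = L_1 + L_0 = 3. *)
fun lucas :: "nat \<Rightarrow> nat" where
  "lucas 0 = 2"
| "lucas (Suc 0) = 1"
| "lucas (Suc (Suc n)) = lucas (Suc n) + lucas n"

lemma lucas_initial: "lucas 1 = 1" "lucas 2 = 3"
  by (simp_all add: numeral_2_eq_2)

(* A may be infinite; each combination uses only a finite subset B of it. *)
definition generated :: "nat set \<Rightarrow> nat set" where
  "generated A = {\<Sum>a\<in>B. c a * a | B c. finite B \<and> B \<subseteq> A}"

(* Meaningful only if the complement of S is finite and nonempty, since Max is
   unspecified on infinite and on empty sets. *)
definition frobenius_number :: "nat set \<Rightarrow> nat" where
  "frobenius_number S = Max (UNIV - S)"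

definition has_frobenius_number :: "nat set \<Rightarrow> bool" where
  "has_frobenius_number S \<longleftrightarrow> finite (UNIV - S) \<and> UNIV - S \<noteq> {}"

end

theory Submission
  imports Defs "HOL-Number_Theory.Cong"
begin

text \<open>
  Let \<open>G\<close> satisfy the Fibonacci recurrence, \<open>a = G n\<close>, \<open>b = G (n + 2)\<close>. The generators are
  \<open>G (n + 2 k) = F\<^bsub>2k\<^esub> b - F\<^bsub>2k-2\<^esub> a\<close>. Consecutive vectors \<open>(F\<^bsub>2k\<^esub>, F\<^bsub>2k-2\<^esub>)\<close> form a basis of the
  integer lattice, so the semigroup consists of all \<open>x b - h a\<close> for which \<open>(x, h)\<close> lies in the
  cone they span, i.e. below the line whose slope is the limit of \<open>F\<^bsub>2k\<^esub> / F\<^bsub>2k+2\<^esub>\<close>. The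
  least element in the residue class of \<open>x b\<close> modulo \<open>a\<close>, for \<open>0 \<le> x < a\<close>, is therefore
  \<open>x b - h a\<close> with \<open>h\<close> as large as possible. It increases with \<open>x\<close>, so the Frobenius number is
  \<open>(a - 1) b - H a\<close> where \<open>H\<close> is the first value of \<open>h\<close> with \<open>(a - 1, h)\<close> above the line. In both
  cases \<open>H = G (n - 2)\<close>.
\<close>

section \<open>Finite combinations of generators\<close>

lemma generated_induct:
  assumes "s \<in> generated A"
    and zero: "P 0" and add: "\<And>s t. P s \<Longrightarrow> P t \<Longrightarrow> P (s + t)" and gen: "\<And>a. a \<in> A \<Longrightarrow> P a"
  shows "P s"
proof -
  obtain B c where s: "s = (\<Sum>a\<in>B. c a * a)" and B: "finite B" "B \<subseteq> A"
    using assms(1) by (auto simp: generated_def)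
  have mult: "P (m * a)" if "a \<in> A" for m a
    by (induction m) (auto intro: zero add gen that)
  from B show ?thesis unfolding s
    by (induction B rule: finite_induct) (auto intro: zero add mult)
qed

text \<open>Two generators suffice for the elements built below. Allowing \<open>u = v\<close>
  avoids having to show that generators are distinct.\<close>

lemma generated_pair:
  assumes "u \<in> A" "v \<in> A"
  shows "p * u + q * v \<in> generated A"
proof (cases "u = v")
  case True
  have "p * u + q * v = (\<Sum>a\<in>{u}. (p + q) * a)"
    using True by (simp add: algebra_simps)
  with assms show ?thesis
    unfolding generated_def by (intro CollectI exI[of _ "{u}"] exI[of _ "\<lambda>_. p + q"]) simp
next
  case False
  then have "p * u + q * v = (\<Sum>a\<in>{u, v}. (if a = u then p else q) * a)"
    by simp
  with assms show ?thesis
    unfolding generated_def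
    by (intro CollectI exI[of _ "{u, v}"] exI[of _ "\<lambda>a. if a = u then p else q"]) simp
qed

section \<open>The cone under the limit of F_{2k} / F_{2k+2}\<close>

text \<open>For \<open>x > 0\<close> this means h / x < (3 - sqrt 5) / 2, the irrational limit of
  the increasing ratios F_{2k} / F_{2k+2}. The existential keeps the condition within the
  integers.\<close>

definition below_slope :: "int \<Rightarrow> int \<Rightarrow> bool" where
  "below_slope x h \<longleftrightarrow> (\<exists>k. int (fib (2 * k + 2)) * h \<le> int (fib (2 * k)) * x)"

lemma fib_even_step: "int (fib (2 * k + 4)) = 3 * int (fib (2 * k + 2)) - int (fib (2 * k))"
  by (simp add: numeral_eq_Suc)

text \<open>The form X^2 - 3 X Y + Y^2 is invariant under (X, Y) -> (3 X - Y, X), the step to the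
  next pair, and is 1 at (1, 0).\<close>

lemma fib_even_norm:
  "(int (fib (2 * k + 2)))\<^sup>2 - 3 * int (fib (2 * k + 2)) * int (fib (2 * k)) + (int (fib (2 * k)))\<^sup>2 = 1"
proof (induction k)
  case (Suc k)
  then show ?case
    using fib_even_step[of k] by (simp add: power2_eq_square algebra_simps)
qed simp

text \<open>The determinant of two consecutive vectors is 1, which yields both the lattice basis and
  the growth of the ratios.\<close>

lemma fib_even_det:
  "(int (fib (2 * k + 2)))\<^sup>2 = int (fib (2 * k)) * int (fib (2 * k + 4)) + 1"
  using fib_even_norm[of k] unfolding fib_even_step by (simp add: power2_eq_square algebra_simps)

lemma fib_even_mono:
  assumes "int (fib (2 * k + 2)) * h \<le> int (fib (2 * k)) * x" "0 \<le> x" "k \<le> l"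
  shows "int (fib (2 * l + 2)) * h \<le> int (fib (2 * l)) * x"
  using assms(3)
proof (induction l rule: dec_induct)
  case base
  show ?case by (fact assms(1))
next
  case (step l)
  define p q r where "p = int (fib (2 * l))" "q = int (fib (2 * l + 2))" "r = int (fib (2 * l + 4))"
  have "q > 0" "r > 0"
    unfolding p_q_r_def of_nat_0_less_iff by (rule fib_neq_0_nat, simp)+
  \<comment> \<open>Scaling by \<open>r\<close> lets the determinant replace \<open>r * p\<close> by
    q^2 - 1; afterwards \<open>q\<close> is cancelled.\<close>
  have "q * (r * h) \<le> r * (p * x)"
    using mult_left_mono[OF step.IH, of r] \<open>r > 0\<close> by (simp add: p_q_r_def algebra_simps)
  also have "\<dots> = q\<^sup>2 * x - x"
    using fib_even_det[of l] by (simp add: p_q_r_def algebra_simps)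
  also have "\<dots> \<le> q * (q * x)" using assms(2) by (simp add: power2_eq_square)
  finally have "r * h \<le> q * x" using \<open>q > 0\<close> by simp
  then show ?case by (simp add: p_q_r_def numeral_eq_Suc)
qed

text \<open>For fixed \<open>k\<close> the condition is linear, so both witnesses are raised to
  their maximum.\<close>

lemma below_slope_add:
  assumes "below_slope x h" "below_slope y i" "0 \<le> x" "0 \<le> y"
  shows "below_slope (x + y) (h + i)"
proof -
  obtain k l where "int (fib (2 * k + 2)) * h \<le> int (fib (2 * k)) * x"
    "int (fib (2 * l + 2)) * i \<le> int (fib (2 * l)) * y"
    using assms by (auto simp: below_slope_def)
  then have "int (fib (2 * max k l + 2)) * h \<le> int (fib (2 * max k l)) * x"
    "int (fib (2 * max k l + 2)) * i \<le> int (fib (2 * max k l)) * y"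
    using assms(3,4) fib_even_mono max.cobounded1 max.cobounded2 by blast+
  then show ?thesis
    unfolding below_slope_def by (intro exI[of _ "max k l"]) (simp add: distrib_left)
qed

text \<open>
  The form vanishes on the line: the limiting slope is the smaller root of \<open>1 - 3 t + t\<^sup>2\<close>.
\<close>

lemma not_below_slope:
  assumes "0 \<le> h" "h \<le> x" "x\<^sup>2 - 3 * x * h + h\<^sup>2 < 0"
  shows "\<not> below_slope x h"
proof
  assume "below_slope x h"
  then obtain k where k: "int (fib (2 * k + 2)) * h \<le> int (fib (2 * k)) * x"
    by (auto simp: below_slope_def)
  define p q where "p = int (fib (2 * k + 2))" "q = int (fib (2 * k))"
  have pq: "0 \<le> q" "q \<le> p" "p * h \<le> q * x"
    using k by (auto simp: p_q_def fib_mono)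
  have "q * x \<le> p * x" using pq assms by (simp add: mult_right_mono)
  moreover have "0 \<le> q * x" using pq assms by simp
  \<comment> \<open>With N(X, Y) = X^2 - 3 X Y + Y^2, this product is p^2 N(x, h) - N(p, q) x^2, and
    N(p, q) = 1.\<close>
  ultimately have "0 \<le> (q * x - p * h) * (3 * p * x - q * x - p * h)"
    using pq by (intro mult_nonneg_nonneg) linarith+
  also have "\<dots> = p\<^sup>2 * (x\<^sup>2 - 3 * x * h + h\<^sup>2) - (p\<^sup>2 - 3 * p * q + q\<^sup>2) * x\<^sup>2"
    by (simp add: power2_eq_square algebra_simps)
  also have "\<dots> = p\<^sup>2 * (x\<^sup>2 - 3 * x * h + h\<^sup>2) - x\<^sup>2"
    using fib_even_norm[of k] by (simp add: p_q_def)
  also have "\<dots> < 0"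
  proof -
    have "p > 0"
      unfolding p_q_def of_nat_0_less_iff by (rule fib_neq_0_nat) simp
    then have "p\<^sup>2 * (x\<^sup>2 - 3 * x * h + h\<^sup>2) < 0" using assms(3) by (simp add: mult_pos_neg)
    then show ?thesis by (smt (verit) zero_le_power2)
  qed
  finally show False by simp
qed

section \<open>Semigroup elements as lattice points of the cone\<close>

text \<open>Both sides satisfy y_{k+2} = 3 y_{k+1} - y_k. Indexing starts at
  \<open>G (n + 2)\<close> because \<open>G n\<close> would need the coefficient F_{-2} =
  -1.\<close>

lemma fibonacci_recurrence_even_shift:
  fixes G :: "nat \<Rightarrow> nat"
  assumes rec: "\<And>m. G (m + 2) = G (m + 1) + G m"
  shows "int (G (n + 2 * k + 2)) = int (fib (2 * k + 2)) * G (n + 2) - int (fib (2 * k)) * G n"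
proof -
  have step: "int (G (m + 4)) = 3 * int (G (m + 2)) - int (G m)" for m
    using rec[of m] rec[of "m + 1"] rec[of "m + 2"] by (simp add: add.commute numeral_eq_Suc)
  show ?thesis
  proof (induction k rule: induct_nat_012)
    case 1
    show ?case using step[of n] by (simp add: numeral_eq_Suc)
  next
    case (ge2 k)
    have "int (G (n + 2 * Suc (Suc k) + 2)) =
        3 * int (G (n + 2 * Suc k + 2)) - int (G (n + 2 * k + 2))"
      using step[of "n + 2 * k + 2"] by (simp add: numeral_eq_Suc)
    moreover have "int (fib (2 * Suc (Suc k) + 2)) =
        3 * int (fib (2 * Suc k + 2)) - int (fib (2 * k + 2))"
      using fib_even_step[of "Suc k"] by (simp add: add.commute)
    moreover have "int (fib (2 * Suc (Suc k))) = 3 * int (fib (2 * Suc k)) - int (fib (2 * k))"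
      using fib_even_step[of k] by (simp add: add.commute)
    ultimately show ?case unfolding ge2 by (simp add: algebra_simps)
  qed simp
qed

text \<open>Forward, the cone contains the generators' vectors and is closed under addition.
  Backward, a point lies between two consecutive rays, and unimodularity makes its coordinates there
  non-negative integers.\<close>

lemma generated_iff_below_slope:
  fixes G :: "nat \<Rightarrow> nat"
  assumes rec: "\<And>m. G (m + 2) = G (m + 1) + G m"
  shows "s \<in> generated {G (n + 2 * k) | k. True} \<longleftrightarrow>
    (\<exists>x h. 0 \<le> x \<and> below_slope x h \<and> int s = x * int (G (n + 2)) - h * int (G n))"
    (is "?S \<longleftrightarrow> ?C s")
proof
  show "?C s" if ?S
    using that
  proof (rule generated_induct)
    show "?C 0" by (intro exI[of _ 0]) (simp add: below_slope_def)
  next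
    fix s t assume "?C s" "?C t"
    then obtain x h y i where *: "0 \<le> x" "below_slope x h" "int s = x * int (G (n + 2)) - h * int (G n)"
      "0 \<le> y" "below_slope y i" "int t = y * int (G (n + 2)) - i * int (G n)" by blast
    then show "?C (s + t)"
      by (intro exI[of _ "x + y"] exI[of _ "h + i"]) (simp add: below_slope_add algebra_simps)
  next
    fix a assume "a \<in> {G (n + 2 * k) | k. True}"
    then obtain k where a: "a = G (n + 2 * k)" by blast
    show "?C a"
    proof (cases k)
      case 0
      \<comment> \<open>The vector of \<open>G n\<close> is (F_0, F_{-2}).\<close>
      have "below_slope 0 (-1)" by (auto simp: below_slope_def intro: exI[of _ 0])
      then show ?thesis using a 0 by (intro exI[of _ 0] exI[of _ "-1"]) simp
    next
      case (Suc j)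
      have "below_slope (int (fib (2 * j + 2))) (int (fib (2 * j)))"
        unfolding below_slope_def by (intro exI[of _ j]) simp
      then show ?thesis
        using a Suc fibonacci_recurrence_even_shift[of G n j, OF rec]
        by (intro exI[of _ "int (fib (2 * j + 2))"] exI[of _ "int (fib (2 * j))"])
          (simp add: add.commute)
    qed
  qed
next
  assume "?C s"
  then obtain x h where x: "0 \<le> x" and "below_slope x h"
    and s: "int s = x * int (G (n + 2)) - h * int (G n)" by blast
  define Q where "Q k \<longleftrightarrow> int (fib (2 * k + 2)) * h \<le> int (fib (2 * k)) * x" for k
  \<comment> \<open>The least witness selects the two rays: the point is under ray \<open>k\<close>
    but not under the one before.\<close>
  define k where "k = (LEAST k. Q k)"
  have "\<exists>k. Q k" using \<open>below_slope x h\<close> by (simp add: below_slope_def Q_def)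
  then have Qk: "Q k" and least: "\<And>j. j < k \<Longrightarrow> \<not> Q j"
    unfolding k_def by (auto intro: LeastI_ex dest: not_less_Least)
  have gen: "G (n + 2 * j) \<in> {G (n + 2 * k) | k. True}" for j by blast
  show ?S
  proof (cases k)
    case 0
    then have "h \<le> 0" using Qk by (simp add: Q_def)
    then have "int s = int (nat x * G (n + 2) + nat (- h) * G n)" using x s by simp
    then show ?thesis
      using generated_pair[OF gen[of 1] gen[of 0]] by (simp only: of_nat_eq_iff) simp
  next
    case (Suc j)
    define p q r where "p = int (fib (2 * j))" "q = int (fib (2 * j + 2))" "r = int (fib (2 * j + 4))"
    have le: "r * h \<le> q * x" using Qk Suc by (simp add: Q_def p_q_r_def numeral_eq_Suc)
    have less: "p * x < q * h" using least[of j] Suc by (simp add: Q_def p_q_r_def)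
    have det: "q * q = p * r + 1" using fib_even_det[of j] by (simp add: p_q_r_def power2_eq_square)
    have G1: "int (G (n + 2 * (j + 1))) = q * int (G (n + 2)) - p * int (G n)"
      using fibonacci_recurrence_even_shift[of G n j, OF rec] by (simp add: p_q_r_def add.commute)
    have G2: "int (G (n + 2 * (j + 2))) = r * int (G (n + 2)) - q * int (G n)"
      using fibonacci_recurrence_even_shift[of G n "j + 1", OF rec]
      by (simp add: p_q_r_def numeral_eq_Suc)
    \<comment> \<open>Cramer's rule: these are the coordinates of (x, h) in the basis (q, p), (r,
      q).\<close>
    have "int (nat (q * x - r * h) * G (n + 2 * (j + 1)) + nat (q * h - p * x) * G (n + 2 * (j + 2)))
        = (q * x - r * h) * (q * int (G (n + 2)) - p * int (G n))
          + (q * h - p * x) * (r * int (G (n + 2)) - q * int (G n))"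
      using le less by (simp only: of_nat_add of_nat_mult G1 G2) simp
    also have "\<dots> = (q * q - p * r) * (x * int (G (n + 2)) - h * int (G n))"
      by (simp add: algebra_simps)
    also have "\<dots> = int s" using det s by simp
    finally show ?thesis
      using generated_pair[OF gen[of "j + 1"] gen[of "j + 2"]] by (metis of_nat_eq_iff)
  qed
qed

section \<open>The Frobenius number from the residue class of (a - 1) b\<close>

text \<open>The line has slope below 1 < b / a. Lowering x by d costs at most d in height on the
  line, whereas a value above \<open>f\<close> already forces h down by at least d.\<close>

lemma frobenius_number_below_slope:
  fixes G :: "nat \<Rightarrow> nat" and H :: int
  assumes rec: "\<And>m. G (m + 2) = G (m + 1) + G m"
    and coprime: "coprime (G n) (G (n + 2))" and pos: "0 < G n" and less: "G n < G (n + 2)"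
    and below: "below_slope (int (G n) - 1) (H - 1)"
    and above: "\<not> below_slope (int (G n) - 1) H"
    and f: "int f = (int (G n) - 1) * int (G (n + 2)) - H * int (G n)"
  defines "S \<equiv> generated {G (n + 2 * k) | k. True}"
  shows "has_frobenius_number S \<and> frobenius_number S = f"
proof -
  define a b where "a = int (G n)" "b = int (G (n + 2))"
  have ab: "0 < a" "a < b" "coprime a b" using pos less coprime by (simp_all add: a_b_def)
  have S: "s \<in> S \<longleftrightarrow> (\<exists>x h. 0 \<le> x \<and> below_slope x h \<and> int s = x * b - h * a)" for s
    unfolding S_def a_b_def by (rule generated_iff_below_slope[OF rec])
  have f': "int f = (a - 1) * b - H * a" using f by (simp add: a_b_def)
  have large: "y \<in> S" if "f < y" for y
  proof -
    obtain u where u: "[b * u = int y] (mod a)"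
      using cong_solve_coprime_int[of b a] ab(3)
      by (metis cong_scalar_right coprime_commute mult.assoc mult_1)
    define x where "x = u mod a"
    have x: "0 \<le> x" "x \<le> a - 1" using ab by (simp_all add: x_def)
    have "[x * b = int y] (mod a)"
      using u unfolding x_def by (simp add: cong_def mod_mult_right_eq mult.commute[of _ b])
    then obtain h where "x * b - int y = a * h" by (auto simp: cong_iff_dvd_diff)
    then have h: "int y = x * b - h * a" by (simp add: algebra_simps)
    define d where "d = a - 1 - x"
    have "d \<ge> 0" using x by (simp add: d_def)
    have "(a - 1) * b - H * a < x * b - h * a" using that f' h by linarith
    then have "d * b < (H - h) * a" by (simp add: d_def algebra_simps)
    moreover have "d * a \<le> d * b" using \<open>d \<ge> 0\<close> ab by (simp add: mult_left_mono)
    ultimately have "d * a < (H - h) * a" by linarith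
    then have hd: "h \<le> H - 1 - d" using ab by simp
    \<comment> \<open>The ray that works at \<open>a - 1\<close> also works at \<open>x\<close>, as
      its slope is at most 1.\<close>
    obtain k where k: "int (fib (2 * k + 2)) * (H - 1) \<le> int (fib (2 * k)) * (a - 1)"
      using below by (auto simp: below_slope_def a_b_def)
    have "int (fib (2 * k + 2)) * h \<le> int (fib (2 * k + 2)) * (H - 1 - d)"
      using hd by (simp add: mult_left_mono)
    also have "\<dots> \<le> int (fib (2 * k)) * (a - 1) - int (fib (2 * k + 2)) * d"
      using k by (simp add: algebra_simps)
    also have "\<dots> \<le> int (fib (2 * k)) * (a - 1) - int (fib (2 * k)) * d"
      using \<open>d \<ge> 0\<close> by (simp add: mult_right_mono fib_mono)
    also have "\<dots> = int (fib (2 * k)) * x" by (simp add: d_def algebra_simps)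
    finally have "below_slope x h" by (auto simp: below_slope_def)
    then show ?thesis using S x h by blast
  qed
  have "f \<notin> S"
  proof
    assume "f \<in> S"
    then obtain x h where x: "0 \<le> x" and "below_slope x h" and fx: "int f = x * b - h * a"
      using S by blast
    then obtain k where k: "int (fib (2 * k + 2)) * h \<le> int (fib (2 * k)) * x"
      by (auto simp: below_slope_def)
    \<comment> \<open>Any representation of \<open>f\<close> is (a - 1, H) shifted by
      \<open>j\<close> times (a, b), and \<open>x \<ge> 0\<close> forces \<open>j \<ge> 0\<close>.
      The shift is steeper than the ray, so undoing it would leave (a - 1, H) under the ray.\<close>
    have eq: "(x - (a - 1)) * b = (h - H) * a" using f' fx by (simp add: algebra_simps)
    then have "a dvd (x - (a - 1)) * b" by simp
    then have "a dvd x - (a - 1)" using ab(3) by (simp add: coprime_dvd_mult_left_iff)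
    then obtain j where j: "x - (a - 1) = a * j" by blast
    have "a * (j + 1) > 0" using x j by (simp add: algebra_simps)
    then have "j \<ge> 0" using ab by (simp add: zero_less_mult_iff)
    have "h - H = j * b" using eq j ab by simp
    then have h: "h = H + j * b" by simp
    have "int (fib (2 * k)) * (j * a) \<le> int (fib (2 * k + 2)) * (j * b)"
      using \<open>j \<ge> 0\<close> ab by (intro mult_mono) (auto simp: fib_mono mult_left_mono)
    moreover have "x = (a - 1) + j * a" using j by (simp add: algebra_simps)
    ultimately have "int (fib (2 * k + 2)) * H \<le> int (fib (2 * k)) * (a - 1)"
      using k unfolding h by (simp add: distrib_left)
    then show False using above by (auto simp: below_slope_def a_b_def)
  qed
  moreover have "UNIV - S \<subseteq> {..f}" using large by (meson DiffE atMost_iff not_le subsetI)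
  ultimately have "finite (UNIV - S)" "f \<in> UNIV - S" "\<And>y. y \<in> UNIV - S \<Longrightarrow> y \<le> f"
    by (auto intro: finite_subset)
  then show ?thesis
    unfolding has_frobenius_number_def frobenius_number_def by (auto intro: Max_eqI)
qed

section \<open>Sequences with the Fibonacci recurrence\<close>

text \<open>The coefficient of \<open>G 0\<close> is F_{m-1}, written as a difference to cover
  \<open>m = 0\<close>.\<close>

lemma fibonacci_recurrence_linear:
  fixes G :: "nat \<Rightarrow> nat"
  assumes rec: "\<And>m. G (m + 2) = G (m + 1) + G m"
  shows "int (G m) = int (fib m) * G 1 + (int (fib (m + 1)) - int (fib m)) * G 0"
proof (induction m rule: induct_nat_012)
  case (ge2 m)
  then show ?case using rec[of m] by (simp add: algebra_simps)
qed simp_all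

lemma fibonacci_recurrence_coprime:
  fixes G :: "nat \<Rightarrow> nat"
  assumes rec: "\<And>m. G (m + 2) = G (m + 1) + G m" and "coprime (G 0) (G 1)"
  shows "coprime (G m) (G (m + 1))"
proof (induction m)
  case (Suc m)
  then show ?case using rec[of m] by (simp add: coprime_commute gcd_add2 coprime_iff_gcd_eq_1)
qed (use assms in simp)

text \<open>Generalized Cassini identity: each step of the recurrence flips the sign of the
  form.\<close>

lemma fibonacci_recurrence_norm:
  fixes G :: "nat \<Rightarrow> nat"
  assumes rec: "\<And>m. G (m + 2) = G (m + 1) + G m"
  shows "(int (G (m + 1)))\<^sup>2 - int (G (m + 1)) * int (G m) - (int (G m))\<^sup>2 =
    (- 1) ^ m * ((int (G 1))\<^sup>2 - int (G 1) * int (G 0) - (int (G 0))\<^sup>2)"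
proof (induction m)
  case (Suc m)
  then show ?case using rec[of m] by (simp add: power2_eq_square algebra_simps)
qed simp

text \<open>The witness is ray \<open>j\<close> for \<open>m = 2 * j\<close> and ray
  \<open>j + 1\<close> for \<open>m = 2 * j + 1\<close>. Cassini's identity collapses the products,
  leaving \<open>G 0\<close> against F_{m+1} for even \<open>m\<close> and \<open>G 1\<close> -
  \<open>G 0\<close> against F_{m+2} for odd \<open>m\<close>.\<close>

lemma below_slope_fibonacci_recurrence:
  fixes G :: "nat \<Rightarrow> nat"
  assumes rec: "\<And>m. G (m + 2) = G (m + 1) + G m"
    and "G 0 \<le> fib (m + 1)" "G 1 \<le> G 0 + 1"
  shows "below_slope (int (G (m + 2)) - 1) (int (G m) - 1)"
proof -
  define j where "j = m div 2"
  define p q u v where "p = int (fib (2 * j))" "q = int (fib (2 * j + 1))"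
    "u = int (G 1)" "v = int (G 0)"
  have norm: "q\<^sup>2 - q * p - p\<^sup>2 = 1"
    using fibonacci_recurrence_norm[of fib "2 * j"] by (simp add: p_q_u_v_def)
  have pos: "0 \<le> p" "1 \<le> q" by (simp_all add: p_q_u_v_def Suc_le_eq fib_neq_0_nat)
  have fibs: "int (fib (2 * j + 2)) = p + q" "int (fib (2 * j + 3)) = p + 2 * q"
    "int (fib (2 * j + 4)) = 2 * p + 3 * q"
    by (simp_all add: p_q_u_v_def numeral_eq_Suc)
  have G: "int (G (2 * j)) = p * u + (q - p) * v" "int (G (2 * j + 1)) = q * u + p * v"
    using fibonacci_recurrence_linear[of G "2 * j", OF rec]
      fibonacci_recurrence_linear[of G "2 * j + 1", OF rec]
    by (simp_all add: p_q_u_v_def)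
  have G': "int (G (2 * j + 2)) = (p + q) * u + q * v"
    "int (G (2 * j + 3)) = (p + 2 * q) * u + (p + q) * v"
    using G rec[of "2 * j"] rec[of "2 * j + 1"] by (simp_all add: algebra_simps numeral_3_eq_3)
  show ?thesis
  proof (cases "even m")
    case True
    then have m: "m = 2 * j" by (simp add: j_def)
    have "v \<le> q" using assms(2) by (simp add: m p_q_u_v_def)
    moreover have "(p + q) * (p * u + (q - p) * v - 1) - p * ((p + q) * u + q * v - 1)
        = (q\<^sup>2 - q * p - p\<^sup>2) * v - q"
      by (simp add: power2_eq_square algebra_simps)
    ultimately have "(p + q) * (p * u + (q - p) * v - 1) \<le> p * ((p + q) * u + q * v - 1)"
      using norm by simp
    then show ?thesis
      unfolding below_slope_def m G G' by (intro exI[of _ j]) (simp only: fibs flip: p_q_u_v_def)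
  next
    case False
    then have m: "m = 2 * j + 1" by (simp add: j_def)
    have "u \<le> v + 1" using assms(3) by (simp add: p_q_u_v_def)
    moreover have "(2 * p + 3 * q) * (q * u + p * v - 1) - (p + q) * ((p + 2 * q) * u + (p + q) * v - 1)
        = (q\<^sup>2 - q * p - p\<^sup>2) * (u - v) - (p + 2 * q)"
      by (simp add: power2_eq_square algebra_simps)
    ultimately have "(2 * p + 3 * q) * (q * u + p * v - 1)
        \<le> (p + q) * ((p + 2 * q) * u + (p + q) * v - 1)"
      using norm pos by simp
    moreover have "2 * (j + 1) + 2 = 2 * j + 4" "2 * (j + 1) = 2 * j + 2"
      "2 * j + 1 + 2 = 2 * j + 3" by simp_all
    ultimately show ?thesis
      unfolding below_slope_def m by (intro exI[of _ "j + 1"]) (simp only: fibs G G')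
  qed
qed

text \<open>Here H = \<open>G m\<close>, and \<open>above\<close> expresses that the form is
  negative at \<open>(G (m + 2) - 1, G m)\<close>. The value is (a - 1) b - H a, regrouped by b - H
  = \<open>G (m + 3) + G (m + 1)\<close>.\<close>

lemma frobenius_number_fibonacci_recurrence:
  fixes G :: "nat \<Rightarrow> nat"
  assumes rec: "\<And>m. G (m + 2) = G (m + 1) + G m" and coprime: "coprime (G 0) (G 1)"
    and pos: "0 < G m" "0 < G (m + 1)"
    and below: "G 0 \<le> fib (m + 1)" "G 1 \<le> G 0 + 1"
    and above: "(- 1) ^ m * ((int (G 1))\<^sup>2 - int (G 1) * int (G 0) - (int (G 0))\<^sup>2)
      + int (G m) + 1 < 2 * int (G (m + 1))"
  defines "S \<equiv> generated {G (m + 2 + 2 * k) | k. True}"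
  shows "has_frobenius_number S"
    and "int (frobenius_number S) =
      int (G (m + 2)) * (int (G (m + 3)) + int (G (m + 1))) - int (G (m + 4))"
proof -
  define s t where "s = int (G (m + 1))" "t = int (G m)"
  have st: "1 \<le> s" "1 \<le> t" using pos by (simp_all add: s_t_def)
  have G: "int (G (m + 2)) = s + t" "int (G (m + 3)) = 2 * s + t" "int (G (m + 4)) = 3 * s + 2 * t"
    using rec[of m] rec[of "m + 1"] rec[of "m + 2"] by (simp_all add: s_t_def numeral_eq_Suc)
  define f where "f = nat ((s + t) * (3 * s + t) - (3 * s + 2 * t))"
  \<comment> \<open>This ensures that \<open>nat\<close> does not truncate in
    \<open>f\<close>.\<close>
  have "2 * (3 * s + t) \<le> (s + t) * (3 * s + t)"
    using st by (intro mult_right_mono) auto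
  then have f: "int f = (s + t) * (3 * s + t) - (3 * s + 2 * t)"
    using st by (simp add: f_def)
  have "s\<^sup>2 - s * t - t\<^sup>2 + t + 1 < 2 * s"
    using above fibonacci_recurrence_norm[of G m, OF rec] by (simp add: s_t_def)
  then have "(s + t - 1)\<^sup>2 - 3 * (s + t - 1) * t + t\<^sup>2 < 0"
    by (simp add: power2_eq_square algebra_simps)
  then have "\<not> below_slope (s + t - 1) t"
    using st by (intro not_below_slope) auto
  then have not_below: "\<not> below_slope (int (G (m + 2)) - 1) t" unfolding G by simp
  have below': "below_slope (int (G (m + 2)) - 1) (t - 1)"
    using below_slope_fibonacci_recurrence[of G m, OF rec below] by (simp add: s_t_def)
  have "coprime (G (m + 2)) (G (m + 3))"
    using fibonacci_recurrence_coprime[of G "m + 2", OF rec coprime] by (simp add: numeral_eq_Suc)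
  then have "coprime (G (m + 2)) (G (m + 2 + 2))"
    using rec[of "m + 2"] by (simp add: coprime_iff_gcd_eq_1 gcd_add2 add.commute numeral_eq_Suc)
  moreover have "0 < G (m + 2)" "G (m + 2) < G (m + 2 + 2)"
    using G st by (simp_all add: numeral_eq_Suc)
  moreover have "int f = (int (G (m + 2)) - 1) * int (G (m + 2 + 2)) - t * int (G (m + 2))"
  proof -
    have "m + 2 + 2 = m + 4" by simp
    then show ?thesis using f by (simp only: G) (simp add: algebra_simps)
  qed
  ultimately have "has_frobenius_number S \<and> frobenius_number S = f"
    unfolding S_def using frobenius_number_below_slope[of G "m + 2", OF rec _ _ _ below' not_below]
    by simp
  then show "has_frobenius_number S" "int (frobenius_number S) =
      int (G (m + 2)) * (int (G (m + 3)) + int (G (m + 1))) - int (G (m + 4))"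
    using f unfolding G by (simp_all add: algebra_simps s_t_def(1))
qed

section \<open>The Fibonacci and Lucas cases\<close>

lemma lucas_pos: "0 < lucas k"
  by (induction k rule: lucas.induct) simp_all

text \<open>With n = m + 2 this is F_{2n} = F_n L_n.\<close>

lemma fib_double: "fib (2 * m + 4) = fib (m + 2) * (fib (m + 3) + fib (m + 1))"
  using fib_add[of "m + 1" "m + 2"] by (simp add: numeral_eq_Suc algebra_simps)

text \<open>With n = m + 2 both sides are 5 F_n L_n; in terms of \<open>s\<close> and
  \<open>t\<close>, L_n = 3 s + t and F_n = s + t.\<close>

lemma lucas_double:
  "lucas (2 * m + 5) + lucas (2 * m + 3) = lucas (m + 2) * (lucas (m + 3) + lucas (m + 1))"
proof -
  have rec: "lucas (k + 2) = lucas (k + 1) + lucas k" for k by simp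
  define s t where "s = int (fib (m + 1))" "t = int (fib m)"
  have L: "int (lucas k) = 2 * int (fib (k + 1)) - int (fib k)" for k
    using fibonacci_recurrence_linear[of lucas k, OF rec] by (simp add: algebra_simps)
  have F: "int (fib (2 * m)) = t * (2 * s - t)" "int (fib (2 * m + 1)) = s\<^sup>2 + t\<^sup>2"
    using fib_add[of m m, THEN arg_cong[of _ _ int]]
      fib_add[of "m + 1" m, THEN arg_cong[of _ _ int]]
    by (simp_all add: s_t_def power2_eq_square algebra_simps flip: mult_2)
  have "int (lucas (2 * m)) = 2 * (s\<^sup>2 + t\<^sup>2) - t * (2 * s - t)"
    "int (lucas (2 * m + 1)) = s\<^sup>2 + t\<^sup>2 + 2 * (t * (2 * s - t))"
    using L[of "2 * m"] L[of "2 * m + 1"] F by simp_all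
  then have "int (lucas (2 * m + 5)) + int (lucas (2 * m + 3)) = (3 * s + t) * (5 * s + 5 * t)"
    by (simp add: numeral_eq_Suc power2_eq_square algebra_simps)
  moreover have "int (lucas (m + 1)) = s + 2 * t" "int (lucas (m + 2)) = 3 * s + t"
    "int (lucas (m + 3)) = 4 * s + 3 * t"
    using L[of m] L[of "m + 1"] by (simp_all add: s_t_def numeral_eq_Suc)
  ultimately have "int (lucas (2 * m + 5)) + int (lucas (2 * m + 3)) =
      int (lucas (m + 2)) * (int (lucas (m + 3)) + int (lucas (m + 1)))"
    by (simp only:) simp
  then show ?thesis by (metis of_nat_add of_nat_eq_iff of_nat_mult)
qed

theorem corollary4p8:
  shows "(\<forall>(n::nat) S. n \<ge> 3 \<and> S = generated {fib (n + 2 * k) | k. True} \<longrightarrow>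
            has_frobenius_number S \<and>
            int (frobenius_number S) = int (fib (2 * n)) - int (fib (n + 2))) \<and>
         (\<forall>(n::nat) S. n \<ge> 4 \<and> S = generated {lucas (n + 2 * k) | k. True} \<longrightarrow>
            has_frobenius_number S \<and>
            int (frobenius_number S) =
              int (lucas (2 * n + 1)) + int (lucas (2 * n - 1)) - int (lucas (n + 2)))"
proof (intro conjI allI impI; elim conjE)
  fix n :: nat and S assume "n \<ge> 3" and S: "S = generated {fib (n + 2 * k) | k. True}"
  define m where "m = n - 2"
  have n: "n = m + 2" "m \<ge> 1" using \<open>n \<ge> 3\<close> by (simp_all add: m_def)
  have above: "(- 1) ^ m + int (fib m) + 1 < 2 * int (fib (m + 1))"
  \<comment> \<open>For \<open>m = 1\<close> the sign -1 is essential; from \<open>m = 2\<close> on,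
    bounding the sign by 1 suffices.\<close>
  proof (cases "m = 1")
    case False
    define l where "l = m - 2"
    have m: "m = l + 2" using False \<open>m \<ge> 1\<close> by (simp add: l_def)
    have "fib (l + 1) \<ge> 1" by (simp add: Suc_le_eq fib_neq_0_nat)
    moreover have "(- 1 :: int) ^ m \<le> 1" by (cases "even m") auto
    moreover have "fib (m + 1) = fib m + fib (l + 1)" "fib m \<ge> fib (l + 1)" by (simp_all add: m)
    ultimately show ?thesis by linarith
  qed simp
  have "0 < fib m" "0 < fib (m + 1)" using n by (auto intro!: fib_neq_0_nat)
  note frobenius = frobenius_number_fibonacci_recurrence[of fib m, OF _ _ this]
  have "int (fib (2 * n)) = int (fib (m + 2)) * (int (fib (m + 3)) + int (fib (m + 1)))"
    using fib_double[of m] by (simp add: n numeral_eq_Suc flip: of_nat_add of_nat_mult)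
  then show "has_frobenius_number S" "int (frobenius_number S) = int (fib (2 * n)) - int (fib (n + 2))"
    using frobenius above unfolding S n by (simp_all add: numeral_eq_Suc)
next
  fix n :: nat and S assume "n \<ge> 4" and S: "S = generated {lucas (n + 2 * k) | k. True}"
  define m where "m = n - 2"
  have n: "n = m + 2" "m \<ge> 2" using \<open>n \<ge> 4\<close> by (simp_all add: m_def)
  \<comment> \<open>-5 is L_1^2 - L_1 L_0 - L_0^2. For \<open>m \<ge> 3\<close> even the worst sign
    leaves 6 against 4 L_{m-2} + 3 L_{m-3} \<ge> 7.\<close>
  have above: "(- 1) ^ m * (- 5) + int (lucas m) + 1 < 2 * int (lucas (m + 1))"
  proof (cases "m = 2")
    case False
    define l where "l = m - 3"
    have m: "m = l + 3" using False n by (simp add: l_def)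
    have "(- 1 :: int) ^ m * (- 5) \<le> 5" by (cases "even m") auto
    moreover have "lucas (m + 1) = lucas m + (lucas (l + 1) + lucas l)"
      "lucas m = lucas (l + 1) + lucas l + lucas (l + 1)" by (simp_all add: m numeral_eq_Suc)
    ultimately show ?thesis using lucas_pos[of l] lucas_pos[of "l + 1"] by linarith
  qed (simp add: numeral_eq_Suc)
  \<comment> \<open>L_0 = 2 must not exceed F_{m+1}, which requires \<open>m \<ge> 2\<close>, that
    is \<open>n \<ge> 4\<close>.\<close>
  have "2 \<le> fib (m + 1)" using fib_mono[of 3 "m + 1"] n by (simp add: numeral_eq_Suc)
  note frobenius = frobenius_number_fibonacci_recurrence[of lucas m, OF _ _ lucas_pos lucas_pos]
  have "int (lucas (2 * n + 1)) + int (lucas (2 * n - 1)) =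
      int (lucas (m + 2)) * (int (lucas (m + 3)) + int (lucas (m + 1)))"
    using lucas_double[of m] by (simp add: n numeral_eq_Suc flip: of_nat_add of_nat_mult)
  then show "has_frobenius_number S" "int (frobenius_number S) =
      int (lucas (2 * n + 1)) + int (lucas (2 * n - 1)) - int (lucas (n + 2))"
    using frobenius above \<open>2 \<le> fib (m + 1)\<close> unfolding S n by (simp_all add: numeral_eq_Suc)
qed

end
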